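(* Let $A\in\mathbb{R}^{n\times d}$, let $f:\mathbb{R}^n\to\mathbb{R}$ be continuously differentiable and $\alpha$-strongly convex with $\alpha>0$, and suppose that $\tilde f(x):=f(Ax)$ is $L$-smooth on $\mathbb{R}^d$. Let $\mathcal{X}=\{x\in\mathbb{R}^d\mid Gx\le h\}$ be a nonempty polyhedral set, and consider $F(x)=f(Ax)+\delta_{\mathcal{X}}(x)$. Assume that the optimal set $\mathcal{X}^*:=\operatorname{argmin}_{x\in\mathcal{X}}f(Ax)$ is nonempty and that $F^*=\min_x F(x)$ is finite. Let $\mathcal{K}\subseteq\mathcal{X}$ and let $H_{\mathcal{K}}$ be the restricted Hoffman constant such that $$\operatorname{dist}(x,\mathcal{X}^* )\le H_{\mathcal{K}}\|A(x-x^* )\|_2\quad\text{for all }x\in\mathcal{K},$$ where $x^*=\mathcal{P}_{\mathcal{X}^*}(x)$ is the Euclidean projection of $x$ onto $\mathcal{X}^*$. Let $\nu_{\mathcal{K}}=\alpha/H_{\mathcal{K}}^2$. If $\nu_{\mathcal{K}}\le L$, then $F$ satisfies the $\mathcal{K}$-restricted proximal PL inequality with constant $\nu_{\mathcal{K}}$, that is, $$\frac12\mathcal{D}_g(x,L)\ge\nu_{\mathcal{K}}\bigl(F(x)-F^*\bigr)\quad\text{for all }x\in\mathcal{K}.$$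
   Context: $\delta_{\mathcal{X}}$ is the indicator function of $\mathcal{X}$ ($0$ on $\mathcal{X}$, $+\infty$ outside), and $\operatorname{dist}$ is Euclidean distance. $\tilde f$ being $L$-smooth (with $L>0$) means $\|\nabla\tilde f(x)-\nabla\tilde f(y)\|_2\le L\|x-y\|_2$ for all $x,y\in\mathbb{R}^d$. With $g:=\delta_{\mathcal{X}}$ and smooth part $\tilde f$, the generalized gradient size is, for $\beta>0$, $$\mathcal{D}_g(x,\beta):=-2\beta\min_{y\in\mathbb{R}^d}\left[\langle\nabla\tilde f(x),y-x\rangle+\frac{\beta}{2}\|y-x\|_2^2+g(y)-g(x)\right].$$ The restricted Hoffman constant $H_{\mathcal{K}}$ is the smallest constant for which the displayed Hoffman-type inequality holds on $\mathcal{K}$; it is taken to be positive so that $\nu_{\mathcal{K}}$ is defined. *)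

theory Defs
  imports "HOL-Analysis.Analysis"
begin

definition gradient :: "('a::real_inner \<Rightarrow> real) \<Rightarrow> 'a \<Rightarrow> 'a" where
  "gradient f x = (THE D. GDERIV f x :> D)"

lemma gradient_eq:
  fixes f :: "'a::real_inner \<Rightarrow> real"
  assumes "GDERIV f x :> D"
  shows "gradient f x = D"
  unfolding gradient_def
proof (rule the_equality[where P = "\<lambda>D. GDERIV f x :> D"])
  show "GDERIV f x :> D" by (fact assms)
next
  fix D' assume "GDERIV f x :> D'"
  then have "(\<lambda>h. inner h D') = (\<lambda>h. inner h D)"
    using assms has_derivative_unique unfolding gderiv_def by blast
  then have "inner h (D' - D) = 0" for h
    by (simp add: inner_diff_right fun_eq_iff)
  then show "D' = D"
    by (metis inner_eq_zero_iff right_minus_eq)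
qed

lemma gradient_works:
  fixes f :: "'a::euclidean_space \<Rightarrow> real"
  assumes "f differentiable (at x)"
  shows "GDERIV f x :> gradient f x"
proof -
  obtain f' where f': "(f has_derivative f') (at x)"
    using assms unfolding differentiable_def by blast
  then interpret f': bounded_linear f' by (rule has_derivative_bounded_linear)
  have "f' h = inner h (adjoint f' 1)" for h
    using adjoint_works[OF f'.linear_axioms, of h 1] by simp
  then have "f' = (\<lambda>h. inner h (adjoint f' 1))" by blast
  with f' have "GDERIV f x :> adjoint f' 1"
    unfolding gderiv_def by metis
  then show ?thesis using gradient_eq by metis
qed

definition continuously_differentiable :: "('a::real_inner \<Rightarrow> real) \<Rightarrow> bool" where
  "continuously_differentiable f \<longleftrightarrow>
     (\<forall>x. f differentiable (at x)) \<and> continuous_on UNIV (gradient f)"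

definition strongly_convex :: "real \<Rightarrow> ('a::real_inner \<Rightarrow> real) \<Rightarrow> bool" where
  "strongly_convex \<alpha> f \<longleftrightarrow>
     (\<forall>x y. \<forall>t\<in>{0..1}. f (t *\<^sub>R x + (1 - t) *\<^sub>R y)
        \<le> t * f x + (1 - t) * f y - \<alpha> / 2 * t * (1 - t) * (norm (x - y))\<^sup>2)"

definition L_smooth :: "real \<Rightarrow> ('a::real_inner \<Rightarrow> real) \<Rightarrow> bool" where
  "L_smooth L f \<longleftrightarrow>
     (\<forall>x. f differentiable (at x)) \<and>
     (\<forall>x y. norm (gradient f x - gradient f y) \<le> L * norm (x - y))"

definition indicator_fun :: "'a set \<Rightarrow> 'a \<Rightarrow> ereal" where
  "indicator_fun X x = (if x \<in> X then 0 else \<infinity>)"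

(* The minimum over y is written as an infimum of extended reals; it is attained in the
   relevant case, see prox_model_attains_min. The value is meaningful only where g x is
   finite, because of the convention \<infinity> - \<infinity> = \<infinity> on ereal. *)
definition prox_model ::
  "('a::real_inner \<Rightarrow> real) \<Rightarrow> ('a \<Rightarrow> ereal) \<Rightarrow> 'a \<Rightarrow> real \<Rightarrow> 'a \<Rightarrow> ereal" where
  "prox_model ft g x \<beta> y =
     ereal (inner (gradient ft x) (y - x) + \<beta> / 2 * (norm (y - x))\<^sup>2) + g y - g x"

definition gen_gradient_size ::
  "('a::real_inner \<Rightarrow> real) \<Rightarrow> ('a \<Rightarrow> ereal) \<Rightarrow> 'a \<Rightarrow> real \<Rightarrow> ereal" where
  "gen_gradient_size ft g x \<beta> = ereal (- 2 * \<beta>) * (INF y. prox_model ft g x \<beta> y)"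

lemma prox_model_attains_min:
  fixes X :: "'a::euclidean_space set"
  assumes "closed X" and x: "x \<in> X" and \<beta>: "\<beta> > 0"
  shows "\<exists>y\<in>X. \<forall>z. prox_model ft (indicator_fun X) x \<beta> y \<le> prox_model ft (indicator_fun X) x \<beta> z"
proof -
  define v where "v = gradient ft x"
  define c where "c = x - (1 / \<beta>) *\<^sub>R v"
  obtain y where y: "y \<in> X" and ymin: "\<And>z. z \<in> X \<Longrightarrow> dist c y \<le> dist c z"
    using distance_attains_inf[OF \<open>closed X\<close>] x by blast
  have eq: "inner v (z - x) + \<beta> / 2 * (norm (z - x))\<^sup>2
      = \<beta> / 2 * (dist c z)\<^sup>2 - (norm v)\<^sup>2 / (2 * \<beta>)" for z
  proof -
    have "dist c z = norm ((z - x) + (1 / \<beta>) *\<^sub>R v)"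
      by (simp add: c_def dist_norm norm_minus_commute algebra_simps)
    then have "(dist c z)\<^sup>2 = inner ((z - x) + (1 / \<beta>) *\<^sub>R v) ((z - x) + (1 / \<beta>) *\<^sub>R v)"
      by (simp only: power2_norm_eq_inner)
    also have "\<dots> = (norm (z - x))\<^sup>2 + 2 / \<beta> * inner v (z - x) + (norm v)\<^sup>2 / \<beta>\<^sup>2"
      unfolding inner_add_left inner_add_right inner_scaleR_left inner_scaleR_right
        power2_norm_eq_inner inner_commute[of "z - x" v]
      using \<beta> by (simp add: field_simps power2_eq_square)
    finally show ?thesis using \<beta> by (simp add: field_simps power2_eq_square)
  qed
  have "prox_model ft (indicator_fun X) x \<beta> y \<le> prox_model ft (indicator_fun X) x \<beta> z" for z
  proof (cases "z \<in> X")
    case True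
    have "\<beta> / 2 * (dist c y)\<^sup>2 \<le> \<beta> / 2 * (dist c z)\<^sup>2"
      using ymin[OF True] \<beta> by (simp add: power_mono)
    then show ?thesis
      using True x y eq[of y] eq[of z] by (simp add: prox_model_def indicator_fun_def v_def)
  next
    case False
    then show ?thesis using x by (simp add: prox_model_def indicator_fun_def)
  qed
  with y show ?thesis by blast
qed

definition hoffman_bound ::
  "real^'d^'n \<Rightarrow> (real^'d) set \<Rightarrow> (real^'d) set \<Rightarrow> real \<Rightarrow> bool" where
  "hoffman_bound A S K c \<longleftrightarrow>
     (\<forall>x\<in>K. infdist x S \<le> c * norm (A *v (x - closest_point S x)))"

(* Minimality ranges over nonnegative constants only: for K \<subseteq> S every real number is a bound,
   and the smallest constant is then 0. *)
definition is_restricted_hoffman_constant ::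
  "real^'d^'n \<Rightarrow> (real^'d) set \<Rightarrow> (real^'d) set \<Rightarrow> real \<Rightarrow> bool" where
  "is_restricted_hoffman_constant A S K H \<longleftrightarrow>
     0 \<le> H \<and> hoffman_bound A S K H \<and> (\<forall>c\<ge>0. hoffman_bound A S K c \<longrightarrow> H \<le> c)"

end

theory Submission
  imports Defs
begin

text \<open>
  Strong convexity of \<open>f\<close> along the segment from \<open>x\<close> to its projection \<open>p\<close> on the optimal set,
  combined with the Hoffman bound, gives
  \<open>F\<^sup>* - F x \<ge> \<langle>\<nabla>(f \<circ> A) x, p - x\<rangle> + \<nu> / 2 * \<parallel>p - x\<parallel>\<^sup>2\<close>.
  The right-hand side, multiplied by \<open>\<nu> / L\<close>, is the value of the proximal model at the
  point \<open>x + (\<nu> / L) (p - x)\<close>, which is feasible because \<open>\<nu> \<le> L\<close>.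
\<close>

text \<open>Dividing the chord bound by \<open>t\<close> bounds the difference quotient along
  \<open>d\<close> by \<open>a - b * (1 - t)\<close>; then \<open>t\<close> tends to 0. With
  \<open>a\<close> the difference of function values and \<open>b\<close> the curvature term, this
  is the form in which strong convexity supplies the bound.\<close>

lemma gderiv_le_of_chord_bound:
  fixes \<phi> :: "'a::real_inner \<Rightarrow> real"
  assumes D: "GDERIV \<phi> x :> v"
    and chord: "\<And>t. \<lbrakk>0 < t; t < 1\<rbrakk> \<Longrightarrow> \<phi> (x + t *\<^sub>R d) \<le> \<phi> x + t * (a - b * (1 - t))"
  shows "inner v d \<le> a - b"
proof -
  have "((\<lambda>t. x + t *\<^sub>R d) has_derivative (\<lambda>t. t *\<^sub>R d)) (at 0)"
    by (auto intro!: derivative_eq_intros)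
  moreover have "(\<phi> has_derivative (\<lambda>h. inner h v)) (at (x + 0 *\<^sub>R d))"
    using D by (simp add: gderiv_def)
  ultimately have "((\<lambda>t. \<phi> (x + t *\<^sub>R d)) has_derivative (\<lambda>t. inner (t *\<^sub>R d) v)) (at 0)"
    by (rule has_derivative_compose)
  then have "((\<lambda>t. \<phi> (x + t *\<^sub>R d)) has_real_derivative inner v d) (at 0)"
    by (simp add: has_field_derivative_def inner_commute mult_commute_abs)
  then have "((\<lambda>t. (\<phi> (x + t *\<^sub>R d) - \<phi> x) / t) \<longlongrightarrow> inner v d) (at 0)"
    by (simp add: DERIV_def)
  \<comment> \<open>The chord bound is available only for positive \<open>t\<close>, so the limit is
    restricted to the right of 0.\<close>
  then have lim: "((\<lambda>t. (\<phi> (x + t *\<^sub>R d) - \<phi> x) / t) \<longlongrightarrow> inner v d) (at_right 0)"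
    by (rule filterlim_mono) (auto simp: at_le)
  have "((\<lambda>t. a - b * (1 - t)) \<longlongrightarrow> a - b * (1 - 0)) (at_right 0)"
    by (intro tendsto_intros)
  moreover have "\<forall>\<^sub>F t in at_right 0. (\<phi> (x + t *\<^sub>R d) - \<phi> x) / t \<le> a - b * (1 - t)"
    unfolding eventually_at_right_field
  proof (intro exI[of _ 1] conjI allI impI)
    fix t :: real
    assume "0 < t" "t < 1"
    then show "(\<phi> (x + t *\<^sub>R d) - \<phi> x) / t \<le> a - b * (1 - t)"
      using chord[of t] by (simp add: divide_le_eq mult.commute)
  qed simp
  ultimately show ?thesis
    using tendsto_le[OF _ _ lim] by fastforce
qed

text \<open>Strong convexity of \<open>f\<close> is applied on the image segment from
  \<open>A *v x\<close> to \<open>A *v y\<close>. The quadratic term therefore sees only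
  \<open>A *v (y - x)\<close>: if \<open>A\<close> has a kernel, the composition need not be
  strongly convex.\<close>

lemma strongly_convex_compose_gradient_bound:
  fixes A :: "real^'d^'n"
  assumes sc: "strongly_convex \<alpha> f"
    and D: "GDERIV (\<lambda>x. f (A *v x)) x :> v"
  shows "inner v (y - x) \<le> f (A *v y) - f (A *v x) - \<alpha> / 2 * (norm (A *v (y - x)))\<^sup>2"
proof (rule gderiv_le_of_chord_bound[OF D])
  fix t :: real
  assume t: "0 < t" "t < 1"
  have "A *v (x + t *\<^sub>R (y - x)) = t *\<^sub>R (A *v y) + (1 - t) *\<^sub>R (A *v x)"
    by (simp add: algebra_simps matrix_vector_mult_scaleR)
  then have "f (A *v (x + t *\<^sub>R (y - x))) \<le> t * f (A *v y) + (1 - t) * f (A *v x)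
      - \<alpha> / 2 * t * (1 - t) * (norm (A *v y - A *v x))\<^sup>2"
    using sc t unfolding strongly_convex_def by simp
  then show "f (A *v (x + t *\<^sub>R (y - x))) \<le> f (A *v x) + t * (f (A *v y) - f (A *v x)
      - \<alpha> / 2 * (norm (A *v (y - x)))\<^sup>2 * (1 - t))"
    by (simp add: algebra_simps)
qed

text \<open>Any feasible trial point bounds the infimum from above, and the negative factor
  \<open>- 2 * \<beta>\<close> turns this into a lower bound. An infimum of minus infinity would
  make the right-hand side infinite.\<close>

lemma gen_gradient_size_indicator_ge:
  fixes X :: "'a::real_inner set"
  assumes "x \<in> X" "y \<in> X" "\<beta> > 0"
  shows "ereal (- \<beta> * (inner (gradient ft x) (y - x) + \<beta> / 2 * (norm (y - x))\<^sup>2))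
    \<le> ereal (1/2) * gen_gradient_size ft (indicator_fun X) x \<beta>"
proof -
  define m where "m = inner (gradient ft x) (y - x) + \<beta> / 2 * (norm (y - x))\<^sup>2"
  have "(INF z. prox_model ft (indicator_fun X) x \<beta> z) \<le> prox_model ft (indicator_fun X) x \<beta> y"
    by (rule INF_lower) simp
  also have "\<dots> = ereal m"
    using assms by (simp add: prox_model_def indicator_fun_def m_def)
  finally have "(INF z. prox_model ft (indicator_fun X) x \<beta> z) \<le> ereal m" .
  then show ?thesis
    using \<open>\<beta> > 0\<close> unfolding gen_gradient_size_def m_def[symmetric]
    by (cases "INF z. prox_model ft (indicator_fun X) x \<beta> z") auto
qed

lemma infdist_eq_dist_closest_point:
  fixes S :: "'a::euclidean_space set"
  assumes "closed S" "S \<noteq> {}"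
  shows "infdist x S = dist x (closest_point S x)"
  using assms
  by (intro antisym infdist_le closest_point_in_set)
    (auto simp: infdist_notempty intro!: cINF_greatest closest_point_le)

lemma convex_polyhedron: "convex {x. (G :: real^'d^'m) *v x \<le> h}"
  unfolding convex_alt
proof (clarsimp simp: less_eq_vec_def)
  fix x y :: "real^'d" and u :: real and i
  assume le: "\<forall>i. (G *v x) $ i \<le> h $ i" "\<forall>i. (G *v y) $ i \<le> h $ i" and u: "0 \<le> u" "u \<le> 1"
  have "(G *v ((1 - u) *\<^sub>R x + u *\<^sub>R y)) $ i = (1 - u) * (G *v x) $ i + u * (G *v y) $ i"
    by (simp add: matrix_vector_right_distrib matrix_vector_mult_scaleR)
  also have "\<dots> \<le> h $ i"
    using le u by (intro convex_bound_le) auto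
  finally show "(G *v ((1 - u) *\<^sub>R x + u *\<^sub>R y)) $ i \<le> h $ i" .
qed

lemma closed_polyhedron: "closed {x. (G :: real^'d^'m) *v x \<le> h}"
  by (simp add: less_eq_vec_def)
    (intro closed_Collect_all closed_Collect_le continuous_intros
      linear_continuous_on matrix_vector_mul_bounded_linear)

theorem proposition2:
  fixes A :: "real^'d^'n" and f :: "real^'n \<Rightarrow> real"
    and G :: "real^'d^'m" and h :: "real^'m"
    and X Xstar K :: "(real^'d) set"
    and ft :: "real^'d \<Rightarrow> real" and g F :: "real^'d \<Rightarrow> ereal"
    and Fstar :: ereal and \<alpha> L H \<nu> :: real
  defines "ft \<equiv> \<lambda>x. f (A *v x)"
    and "X \<equiv> {x. G *v x \<le> h}"
    and "g \<equiv> indicator_fun X"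
    and "F \<equiv> \<lambda>x. ereal (ft x) + g x"
    and "Xstar \<equiv> {x. is_arg_min ft (\<lambda>y. y \<in> X) x}"
    and "Fstar \<equiv> (INF x. F x)"
    and "\<nu> \<equiv> \<alpha> / H\<^sup>2"
  assumes "continuously_differentiable f"
    and "\<alpha> > 0" and "strongly_convex \<alpha> f"
    and "L > 0" and "L_smooth L ft"
    and "X \<noteq> {}" and "Xstar \<noteq> {}" and "\<bar>Fstar\<bar> \<noteq> \<infinity>"
    and "K \<subseteq> X"
    and "is_restricted_hoffman_constant A Xstar K H" and "H > 0"
    and "\<nu> \<le> L"
  shows "\<forall>x\<in>K. ereal (1/2) * gen_gradient_size ft g x L \<ge> ereal \<nu> * (F x - Fstar)"
proof
  fix x
  assume "x \<in> K"
  then have x: "x \<in> X"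
    using \<open>K \<subseteq> X\<close> by blast
  have diff: "ft differentiable (at z)" for z
    using \<open>L_smooth L ft\<close> by (simp add: L_smooth_def)
  have Xstar_eq: "Xstar = {z \<in> X. \<forall>y\<in>X. ft z \<le> ft y}"
    unfolding Xstar_def by (auto simp: is_arg_min_linorder)
  have "continuous_on UNIV ft"
    using diff by (simp add: continuous_at_imp_continuous_on differentiable_imp_continuous_within)
  \<comment> \<open>Closedness of \<open>Xstar\<close> makes the projection a member of it. In
    \<open>closed_Collect_imp\<close> the premise \<open>y \<in> X\<close> does not depend on
    \<open>z\<close>, so it defines an open set: everything or nothing.\<close>
  then have "closed {z. \<forall>y\<in>X. ft z \<le> ft y}"
    unfolding Ball_def
    by (intro closed_Collect_all closed_Collect_imp closed_Collect_le) auto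
  moreover have "Xstar = X \<inter> {z. \<forall>y\<in>X. ft z \<le> ft y}"
    using Xstar_eq by blast
  ultimately have "closed Xstar"
    using closed_polyhedron[of G h] by (auto simp: X_def)
  define p where "p = closest_point Xstar x"
  have "p \<in> Xstar"
    unfolding p_def using \<open>closed Xstar\<close> \<open>Xstar \<noteq> {}\<close> by (rule closest_point_in_set)
  then have p: "p \<in> X" and pmin: "\<And>y. y \<in> X \<Longrightarrow> ft p \<le> ft y"
    using Xstar_eq by auto
  have "Fstar = ereal (ft p)"
    unfolding Fstar_def
  proof (rule antisym)
    show "(INF z. F z) \<le> ereal (ft p)"
      using p by (intro INF_lower2[of p]) (auto simp: F_def g_def indicator_fun_def)
    show "ereal (ft p) \<le> (INF z. F z)"
      using pmin by (intro INF_greatest) (auto simp: F_def g_def indicator_fun_def)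
  qed
  then have gap: "F x - Fstar = ereal (ft x - ft p)"
    using x by (simp add: F_def g_def indicator_fun_def)
  \<comment> \<open>\<open>assms(17)\<close> is the Hoffman hypothesis, since the seven
    \<open>defines\<close> are counted first.\<close>
  have "dist x p \<le> H * norm (A *v (x - p))"
    using assms(17) \<open>x \<in> K\<close> infdist_eq_dist_closest_point[OF \<open>closed Xstar\<close> \<open>Xstar \<noteq> {}\<close>]
    by (auto simp: is_restricted_hoffman_constant_def hoffman_bound_def p_def)
  then have "norm (p - x) \<le> H * norm (A *v (p - x))"
    by (simp add: dist_norm norm_minus_commute matrix_vector_mult_diff_distrib)
  then have "(norm (p - x))\<^sup>2 \<le> H\<^sup>2 * (norm (A *v (p - x)))\<^sup>2"
    unfolding power_mult_distrib[symmetric] by (rule power_mono) simp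
  \<comment> \<open>Scaling by \<alpha> / \<open>H\<^sup>2\<close> trades the curvature in
    \<open>A *v (p - x)\<close> for curvature \<nu> in the Euclidean distance to
    \<open>p\<close>.\<close>
  then have hoffman: "\<nu> * (norm (p - x))\<^sup>2 \<le> \<alpha> * (norm (A *v (p - x)))\<^sup>2"
    using \<open>\<alpha> > 0\<close> \<open>H > 0\<close> by (simp add: \<nu>_def field_simps)
  have "inner (gradient ft x) (p - x) \<le> ft p - ft x - \<alpha> / 2 * (norm (A *v (p - x)))\<^sup>2"
    using strongly_convex_compose_gradient_bound[OF \<open>strongly_convex \<alpha> f\<close>]
      gradient_works[OF diff[of x]] unfolding ft_def by blast
  with hoffman have key: "inner (gradient ft x) (p - x) + \<nu> / 2 * (norm (p - x))\<^sup>2 \<le> ft p - ft x"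
    by simp
  define t where "t = \<nu> / L"
  have "\<nu> > 0"
    using \<open>\<alpha> > 0\<close> \<open>H > 0\<close> by (simp add: \<nu>_def)
  then have t: "0 \<le> t" "t \<le> 1" "L * t = \<nu>"
    using \<open>L > 0\<close> \<open>\<nu> \<le> L\<close> by (auto simp: t_def)
  define y where "y = (1 - t) *\<^sub>R x + t *\<^sub>R p"
  have "y \<in> X"
    using convex_polyhedron[of G h] x p t unfolding X_def y_def convex_alt by blast
  have yx: "y - x = t *\<^sub>R (p - x)"
    by (simp add: y_def algebra_simps)
  \<comment> \<open>The linear term scales with \<open>t\<close> and the quadratic one with
    \<open>t\<^sup>2\<close>. As \<open>L * t = \<nu>\<close>, the result is \<nu> times the model
    at \<open>p\<close> with parameter \<nu>, which is what \<open>key\<close> bounds.\<close>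
  have "L * (inner (gradient ft x) (y - x) + L / 2 * (norm (y - x))\<^sup>2)
      = (L * t) * (inner (gradient ft x) (p - x) + (L * t) / 2 * (norm (p - x))\<^sup>2)"
    unfolding yx norm_scaleR inner_scaleR_right power_mult_distrib power2_abs
    by (simp add: field_simps power2_eq_square)
  also have "\<dots> \<le> \<nu> * (ft p - ft x)"
    unfolding t(3) using key \<open>\<nu> > 0\<close> by (simp add: mult_left_mono)
  finally have "\<nu> * (ft x - ft p)
      \<le> - L * (inner (gradient ft x) (y - x) + L / 2 * (norm (y - x))\<^sup>2)"
    by (simp add: algebra_simps)
  then have "ereal \<nu> * (F x - Fstar)
      \<le> ereal (- L * (inner (gradient ft x) (y - x) + L / 2 * (norm (y - x))\<^sup>2))"
    by (simp add: gap)
  also have "\<dots> \<le> ereal (1/2) * gen_gradient_size ft g x L"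
    unfolding g_def by (rule gen_gradient_size_indicator_ge[OF x \<open>y \<in> X\<close> \<open>L > 0\<close>])
  finally show "ereal \<nu> * (F x - Fstar) \<le> ereal (1/2) * gen_gradient_size ft g x L" .
qed

end
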